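(* Let $n\geq 2$ and let $\pi(n)$ be a finite projective plane of order $n$ with point set $\{1,\ldots,n^2+n+1\}$ and lines $l_1,\ldots,l_{n^2+n+1}$. Let $r_1\geq r_2\geq\cdots\geq r_{n^2+n+1}\geq 1$ be integers. If $\sum_{i=n+2}^{n^2+n+1} r_i>2(n+1)$, then $Erd(r_1,\ldots,r_{n^2+n+1})\notin\mathfrak{N}$.
   Context: All graphs are finite, without loops or multiple edges. An interval $t$-coloring of a graph $G$ is a proper edge-coloring of $G$ with colors $1,\ldots,t$ such that every color is used and for every vertex $v$ the set of colors of edges incident to $v$ is an interval of integers. $\mathfrak{N}$ denotes the set of graphs having an interval $t$-coloring for some positive integer $t$. A finite projective plane of order $n$ has $n^2+n+1$ points and $n^2+n+1$ lines, any two points lie on a unique common line, any two lines meet in a unique point, every point is on $n+1$ lines and every line contains $n+1$ points. Given such a plane with lines $l_1,\ldots,l_{n^2+n+1}$ and integers $r_1\geq\cdots\geq r_{n^2+n+1}\geq1$, the graph $Erd(r_1,\ldots,r_{n^2+n+1})$ has vertex set $\{u\}\cup\{1,\ldots,n^2+n+1\}\cup\{v^{(l_i)}_1,\ldots,v^{(l_i)}_{r_i}:1\leq i\leq n^2+n+1\}$ and edges $uv^{(l_i)}_p$ for all $i$ and $1\leq p\leq r_i$, together with edges $v^{(l_i)}_p k$ for all $i$, $1\leq p\leq r_i$ and every point $k$ on the line $l_i$. It is a connected bipartite graph with maximum degree $\sum_i r_i$. *)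

theory Defs
  imports Main
begin

text \<open>A graph is a pair of a vertex set and an edge set; an edge is the two-element set of its
  end vertices, so there are no multiple edges.\<close>

type_synonym 'a graph = "'a set \<times> 'a set set"

definition simple_graph :: "'a graph \<Rightarrow> bool" where
  "simple_graph G \<longleftrightarrow> finite (fst G) \<and> (\<forall>e\<in>snd G. e \<subseteq> fst G \<and> card e = 2)"

definition proper_edge_coloring :: "'a graph \<Rightarrow> ('a set \<Rightarrow> nat) \<Rightarrow> bool" where
  "proper_edge_coloring G c \<longleftrightarrow>
     (\<forall>e\<in>snd G. \<forall>f\<in>snd G. e \<noteq> f \<and> e \<inter> f \<noteq> {} \<longrightarrow> c e \<noteq> c f)"

text \<open>The empty interval is allowed (take \<open>a > b\<close>), so isolated vertices impose no condition.\<close>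

definition interval_coloring :: "'a graph \<Rightarrow> nat \<Rightarrow> ('a set \<Rightarrow> nat) \<Rightarrow> bool" where
  "interval_coloring G t c \<longleftrightarrow>
     proper_edge_coloring G c \<and> c ` snd G = {1..t} \<and>
     (\<forall>v\<in>fst G. \<exists>a b. c ` {e \<in> snd G. v \<in> e} = {a..b})"

definition interval_colorable_graphs :: "'a graph set" ("\<NN>") where
  "\<NN> = {G. simple_graph G \<and> (\<exists>t\<ge>1. \<exists>c. interval_coloring G t c)}"

definition projective_plane :: "nat \<Rightarrow> 'p set \<Rightarrow> 'p set set \<Rightarrow> bool" where
  "projective_plane n P L \<longleftrightarrow>
     card P = n\<^sup>2 + n + 1 \<and> card L = n\<^sup>2 + n + 1 \<and> (\<forall>l\<in>L. l \<subseteq> P) \<and>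
     (\<forall>p\<in>P. \<forall>q\<in>P. p \<noteq> q \<longrightarrow> (\<exists>!l. l \<in> L \<and> p \<in> l \<and> q \<in> l)) \<and>
     (\<forall>l\<in>L. \<forall>m\<in>L. l \<noteq> m \<longrightarrow> (\<exists>!p. p \<in> l \<and> p \<in> m)) \<and>
     (\<forall>p\<in>P. card {l \<in> L. p \<in> l} = n + 1) \<and>
     (\<forall>l\<in>L. card l = n + 1)"

text \<open>\<open>Hub\<close> is the vertex \<open>u\<close>, \<open>Point k\<close> the vertex \<open>k\<close>, and \<open>Copy i p\<close> the \<open>p\<close>-th of
  the \<open>r i\<close> vertices belonging to the line \<open>l i\<close>.\<close>

datatype erd_vertex = Hub | Point nat | Copy nat nat

definition Erd :: "nat \<Rightarrow> (nat \<Rightarrow> nat set) \<Rightarrow> (nat \<Rightarrow> nat) \<Rightarrow> erd_vertex graph" where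
  "Erd n l r =
     ({Hub} \<union> Point ` {1..n\<^sup>2 + n + 1} \<union>
        {Copy i p | i p. i \<in> {1..n\<^sup>2 + n + 1} \<and> p \<in> {1..r i}},
      {{Hub, Copy i p} | i p. i \<in> {1..n\<^sup>2 + n + 1} \<and> p \<in> {1..r i}} \<union>
        {{Copy i p, Point k} | i p k. i \<in> {1..n\<^sup>2 + n + 1} \<and> p \<in> {1..r i} \<and> k \<in> l i})"

lemma simple_graph_Erd:
  assumes "projective_plane n {1..n\<^sup>2 + n + 1} L"
    and "bij_betw l {1..n\<^sup>2 + n + 1} L"
  shows "simple_graph (Erd n l r)"
proof -
  let ?N = "n\<^sup>2 + n + 1"
  have l: "k \<in> {1..?N}" if "i \<in> {1..?N}" "k \<in> l i" for i k
  proof -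
    have "l i \<in> L" using assms(2) that(1) by (rule bij_betw_apply)
    then have "l i \<subseteq> {1..?N}" using assms(1) unfolding projective_plane_def by (elim conjE) (rule bspec)
    then show ?thesis using that(2) by (rule subsetD)
  qed
  have "{Copy i p | i p. i \<in> {1..?N} \<and> p \<in> {1..r i}} =
      case_prod Copy ` (SIGMA i:{1..?N}. {1..r i})"
    by auto
  then have "finite {Copy i p | i p. i \<in> {1..?N} \<and> p \<in> {1..r i}}"
    by simp
  then have "finite (fst (Erd n l r))"
    unfolding Erd_def by simp
  moreover have "e \<subseteq> fst (Erd n l r) \<and> card e = 2" if "e \<in> snd (Erd n l r)" for e
  proof -
    have "(\<exists>i p. e = {Hub, Copy i p} \<and> i \<in> {1..?N} \<and> p \<in> {1..r i}) \<or>
        (\<exists>i p k. e = {Copy i p, Point k} \<and> i \<in> {1..?N} \<and> p \<in> {1..r i} \<and> k \<in> l i)"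
      using that unfolding Erd_def snd_conv by blast
    then show ?thesis
    proof (elim disjE exE conjE)
      fix i p assume "e = {Hub, Copy i p}" "i \<in> {1..?N}" "p \<in> {1..r i}"
      then show ?thesis unfolding Erd_def fst_conv by simp
    next
      fix i p k assume "e = {Copy i p, Point k}" "i \<in> {1..?N}" "p \<in> {1..r i}" "k \<in> l i"
      moreover from this have "k \<in> {1..?N}" using l by blast
      ultimately show ?thesis unfolding Erd_def fst_conv by simp
    qed
  qed
  ultimately show ?thesis
    unfolding simple_graph_def by blast
qed

end

theory Submission
  imports Defs
begin

text \<open>The colors at the hub fill an interval of length \<open>\<Sum>i. r i\<close>, and its two extreme colors occur on
  edges to copies of lines \<open>l i\<close> and \<open>l j\<close>. These lines share a point \<open>k\<close>. Since a copy has degree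
  \<open>n + 2\<close>, passing from its hub edge to its edge at \<open>k\<close> changes the color by at most \<open>n + 1\<close>, so the
  degree of \<open>k\<close> is at least \<open>(\<Sum>i. r i) - 2 * (n + 1)\<close>. But only \<open>n + 1\<close> lines pass through \<open>k\<close>, so
  its degree is at most the sum of the \<open>n + 1\<close> largest \<open>r i\<close>.\<close>

definition incident_edges :: "'a graph \<Rightarrow> 'a \<Rightarrow> 'a set set" where
  "incident_edges G v = {e \<in> snd G. v \<in> e}"

text \<open>Properness makes \<open>c\<close> injective on the edges at \<open>v\<close>, so the
  degree of \<open>v\<close> is the length of its color interval. Truncated subtraction in
  \<open>Suc b - a\<close> also gives the right value 0 for an empty interval.\<close>

lemma interval_coloring_incident:
  assumes "interval_coloring G t c" and "v \<in> fst G"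
  obtains a b where "c ` incident_edges G v = {a..b}"
    and "card (incident_edges G v) = Suc b - a"
proof -
  obtain a b where ab: "c ` incident_edges G v = {a..b}"
    using assms unfolding interval_coloring_def incident_edges_def by blast
  have "inj_on c (incident_edges G v)"
    using assms(1)
    unfolding inj_on_def interval_coloring_def proper_edge_coloring_def incident_edges_def
    by blast
  then have "card (incident_edges G v) = Suc b - a"
    using card_image ab by fastforce
  with ab show thesis by (rule that)
qed

lemma interval_coloring_spread:
  assumes "interval_coloring G t c" and "v \<in> fst G"
    and "e \<in> incident_edges G v" and "f \<in> incident_edges G v"
  shows "c f < c e + card (incident_edges G v)"
proof -
  obtain a b where ab: "c ` incident_edges G v = {a..b}"
    "card (incident_edges G v) = Suc b - a"
    using interval_coloring_incident assms(1,2) .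
  have "c e \<in> {a..b}" "c f \<in> {a..b}"
    using assms(3,4) ab(1) by blast+
  with ab(2) show ?thesis by auto
qed

lemma interval_coloring_extremes:
  assumes "interval_coloring G t c" and "v \<in> fst G" and "incident_edges G v \<noteq> {}"
  obtains e f where "e \<in> incident_edges G v" and "f \<in> incident_edges G v"
    and "Suc (c f) = c e + card (incident_edges G v)"
proof -
  obtain a b where ab: "c ` incident_edges G v = {a..b}"
    "card (incident_edges G v) = Suc b - a"
    using interval_coloring_incident assms(1,2) .
  have "a \<le> b" using assms(3) ab(1) by fastforce
  then have "a \<in> c ` incident_edges G v" "b \<in> c ` incident_edges G v"
    using ab(1) by simp_all
  then obtain e f where "e \<in> incident_edges G v" "c e = a" "f \<in> incident_edges G v" "c f = b"
    by blast
  with that ab(2) \<open>a \<le> b\<close> show thesis by simp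
qed

text \<open>Exchange argument with threshold \<open>r m\<close>: \<open>S\<close> and
  \<open>{1..m}\<close> have equally many elements outside their intersection, and there the values
  of \<open>r\<close> are at most \<open>r m\<close> on the side of \<open>S\<close> and at least
  \<open>r m\<close> on the other side.\<close>

lemma sum_le_sum_initial_segment:
  fixes r :: "nat \<Rightarrow> nat"
  assumes "\<And>i j. 1 \<le> i \<Longrightarrow> i \<le> j \<Longrightarrow> j \<le> N \<Longrightarrow> r j \<le> r i"
    and "S \<subseteq> {1..N}" and "card S = m" and "1 \<le> m"
  shows "sum r S \<le> sum r {1..m}"
proof -
  let ?T = "{1..m}"
  have fS: "finite S" using assms(2) finite_subset by blast
  have "m \<le> N" using card_mono[OF _ assms(2)] assms(3) by simp
  have card_eq: "card (S - ?T) = card (?T - S)"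
    using fS assms(3) by (simp add: card_Diff_subset_Int Int_commute)
  have "sum r (S - ?T) \<le> card (S - ?T) * r m"
  proof -
    have "r i \<le> r m" if "i \<in> S - ?T" for i
      using that assms(2,4) by (intro assms(1)) auto
    then show ?thesis using sum_bounded_above[of "S - ?T" r "r m"] by simp
  qed
  also have "\<dots> = card (?T - S) * r m"
    by (simp only: card_eq)
  also have "\<dots> \<le> sum r (?T - S)"
  proof -
    have "r m \<le> r i" if "i \<in> ?T - S" for i
      using that \<open>m \<le> N\<close> by (intro assms(1)) auto
    then show ?thesis using sum_bounded_below[of "?T - S" "r m" r] by simp
  qed
  finally have "sum r (S - ?T) \<le> sum r (?T - S)" .
  moreover have "sum r S = sum r (S \<inter> ?T) + sum r (S - ?T)"
    using fS by (rule sum.Int_Diff)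
  moreover have "sum r ?T = sum r (?T \<inter> S) + sum r (?T - S)"
    by (rule sum.Int_Diff) simp
  ultimately show ?thesis by (simp add: Int_commute)
qed

lemma incident_edges_Erd_Hub:
  "incident_edges (Erd n l r) Hub =
     (\<lambda>(i, p). {Hub, Copy i p}) ` (SIGMA i:{1..n\<^sup>2 + n + 1}. {1..r i})"
  unfolding incident_edges_def Erd_def by (auto simp: image_iff) blast+

lemma card_incident_edges_Erd_Hub:
  "card (incident_edges (Erd n l r) Hub) = (\<Sum>i=1..n\<^sup>2 + n + 1. r i)"
proof -
  have "inj_on (\<lambda>(i, p). {Hub, Copy i p}) (SIGMA i:{1..n\<^sup>2 + n + 1}. {1..r i})"
    by (auto simp: inj_on_def doubleton_eq_iff)
  then show ?thesis
    unfolding incident_edges_Erd_Hub by (simp add: card_image)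
qed

text \<open>The neighbors of a copy are the hub and the points of its line. Only the upper bound
  matters, since a degree serves here as a bound on color spread; it holds even when
  \<open>Copy i p\<close> is not a vertex.\<close>

lemma card_incident_edges_Erd_Copy_le:
  assumes "finite (l i)"
  shows "card (incident_edges (Erd n l r) (Copy i p)) \<le> Suc (card (l i))"
proof -
  let ?E = "insert {Hub, Copy i p} ((\<lambda>k. {Copy i p, Point k}) ` l i)"
  have "incident_edges (Erd n l r) (Copy i p) \<subseteq> ?E"
    unfolding incident_edges_def Erd_def by auto
  then have "card (incident_edges (Erd n l r) (Copy i p)) \<le> card ?E"
    using assms by (intro card_mono) simp_all
  also have "\<dots> \<le> Suc (card ((\<lambda>k. {Copy i p, Point k}) ` l i))"
    by (rule card_insert_le_m1) simp_all
  also have "\<dots> \<le> Suc (card (l i))"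
    using assms card_image_le by simp
  finally show ?thesis .
qed

lemma card_incident_edges_Erd_Point_le:
  "card (incident_edges (Erd n l r) (Point k)) \<le> sum r {i \<in> {1..n\<^sup>2 + n + 1}. k \<in> l i}"
proof -
  let ?S = "SIGMA i:{i \<in> {1..n\<^sup>2 + n + 1}. k \<in> l i}. {1..r i}"
  have "incident_edges (Erd n l r) (Point k) \<subseteq> (\<lambda>(i, p). {Copy i p, Point k}) ` ?S"
    unfolding incident_edges_def Erd_def by auto
  then have "card (incident_edges (Erd n l r) (Point k)) \<le> card ?S"
    by (intro surj_card_le) simp_all
  also have "\<dots> = sum r {i \<in> {1..n\<^sup>2 + n + 1}. k \<in> l i}"
    by simp
  finally show ?thesis .
qed

lemma interval_coloring_Erd_point_degree:
  assumes "projective_plane n {1..n\<^sup>2 + n + 1} L"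
    and "bij_betw l {1..n\<^sup>2 + n + 1} L"
    and "interval_coloring (Erd n l r) t c"
    and "(\<Sum>i=1..n\<^sup>2 + n + 1. r i) > 0"
  obtains k where "k \<in> {1..n\<^sup>2 + n + 1}"
    and "(\<Sum>i=1..n\<^sup>2 + n + 1. r i) \<le> card (incident_edges (Erd n l r) (Point k)) + 2 * (n + 1)"
proof -
  let ?N = "n\<^sup>2 + n + 1" and ?G = "Erd n l r"
  have lL: "l i \<in> L" if "i \<in> {1..?N}" for i
    using assms(2) that by (rule bij_betw_apply)
  have plane: "\<forall>l\<in>L. l \<subseteq> {1..?N}" "\<forall>l\<in>L. card l = n + 1"
    "\<forall>l\<in>L. \<forall>m\<in>L. l \<noteq> m \<longrightarrow> (\<exists>!p. p \<in> l \<and> p \<in> m)"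
    using assms(1) unfolding projective_plane_def by simp_all
  have card_line: "card (l i) = n + 1" if "i \<in> {1..?N}" for i
    using plane(2) lL[OF that] by simp
  have points: "l i \<subseteq> {1..?N}" if "i \<in> {1..?N}" for i
    using plane(1) lL[OF that] by (rule bspec)
  have meet: "\<exists>k. k \<in> l i \<and> k \<in> l j" if "i \<in> {1..?N}" "j \<in> {1..?N}" for i j
  \<comment> \<open>The two extreme hub edges may lead to copies of one line, a case outside the
    plane axiom on distinct lines; then any point of that line will do.\<close>
  proof (cases "l i = l j")
    case True
    have "l i \<noteq> {}" using card_line[OF that(1)] by force
    with True show ?thesis by blast
  next
    case False
    with plane(3) lL[OF that(1)] lL[OF that(2)] show ?thesis by blast
  qed
  \<comment> \<open>A copy has degree at most \<open>n + 2\<close>, one edge to the hub and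
    \<open>n + 1\<close> to points, so its colors differ by at most \<open>n + 1\<close>.\<close>
  have copy_spread: "c f \<le> c e + (n + 1)"
    if "i \<in> {1..?N}" "p \<in> {1..r i}" "e \<in> incident_edges ?G (Copy i p)"
      "f \<in> incident_edges ?G (Copy i p)" for i p e f
  proof -
    have "Copy i p \<in> fst ?G" using that(1,2) unfolding Erd_def by simp
    then have "c f < c e + card (incident_edges ?G (Copy i p))"
      using interval_coloring_spread[OF assms(3)] that(3,4) by simp
    moreover have "card (incident_edges ?G (Copy i p)) \<le> n + 2"
      using card_incident_edges_Erd_Copy_le[of l i n r p] card_line[OF that(1)]
        finite_subset[OF points[OF that(1)]] by simp
    ultimately show ?thesis by simp
  qed
  have "incident_edges ?G Hub \<noteq> {}"
    using card_incident_edges_Erd_Hub[of n l r] assms(4) by force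
  moreover have "Hub \<in> fst ?G" unfolding Erd_def by simp
  ultimately obtain e f where e: "e \<in> incident_edges ?G Hub" and f: "f \<in> incident_edges ?G Hub"
    and ef: "Suc (c f) = c e + card (incident_edges ?G Hub)"
    using interval_coloring_extremes assms(3) by metis
  obtain i p where ip: "i \<in> {1..?N}" "p \<in> {1..r i}" "e = {Hub, Copy i p}"
    using e unfolding incident_edges_Erd_Hub by auto
  obtain j q where jq: "j \<in> {1..?N}" "q \<in> {1..r j}" "f = {Hub, Copy j q}"
    using f unfolding incident_edges_Erd_Hub by auto
  obtain k where k: "k \<in> l i" "k \<in> l j" using meet ip(1) jq(1) by blast
  let ?e = "{Copy i p, Point k}" and ?f = "{Copy j q, Point k}"
  have e': "?e \<in> snd ?G" and f': "?f \<in> snd ?G"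
    using ip(1,2) jq(1,2) k unfolding Erd_def by auto
  have "c ?e \<le> c e + (n + 1)"
    using copy_spread[OF ip(1,2)] e e' ip(3) unfolding incident_edges_def by blast
  moreover have "c f \<le> c ?f + (n + 1)"
    using copy_spread[OF jq(1,2)] f f' jq(3) unfolding incident_edges_def by blast
  moreover have kN: "k \<in> {1..?N}" using points ip(1) k(1) by blast
  moreover have "c ?f < c ?e + card (incident_edges ?G (Point k))"
  proof (rule interval_coloring_spread[OF assms(3)])
    show "Point k \<in> fst ?G" using kN unfolding Erd_def by simp
  qed (use e' f' in \<open>simp_all add: incident_edges_def\<close>)
  \<comment> \<open>Chain the bounds along \<open>f\<close>, \<open>?f\<close>, \<open>?e\<close>,
    \<open>e\<close>: each copy contributes \<open>n + 1\<close>, and the strict inequality at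
    \<open>k\<close> absorbs the \<open>Suc\<close> in \<open>ef\<close>.\<close>
  ultimately have "card (incident_edges ?G Hub) \<le>
      card (incident_edges ?G (Point k)) + 2 * (n + 1)"
    using ef by simp
  with kN that show thesis unfolding card_incident_edges_Erd_Hub by blast
qed

theorem theorem7:
  fixes n :: nat and L :: "nat set set" and l :: "nat \<Rightarrow> nat set" and r :: "nat \<Rightarrow> nat"
  assumes "n \<ge> 2"
    and "projective_plane n {1..n\<^sup>2 + n + 1} L"
    and "bij_betw l {1..n\<^sup>2 + n + 1} L"
    and "\<And>i j. 1 \<le> i \<Longrightarrow> i \<le> j \<Longrightarrow> j \<le> n\<^sup>2 + n + 1 \<Longrightarrow> r i \<ge> r j"
    and "r (n\<^sup>2 + n + 1) \<ge> 1"
    and "(\<Sum>i=n+2..n\<^sup>2 + n + 1. r i) > 2 * (n + 1)"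
  shows "Erd n l r \<notin> \<NN>"
proof
  let ?N = "n\<^sup>2 + n + 1"
  assume "Erd n l r \<in> \<NN>"
  then obtain t c where "interval_coloring (Erd n l r) t c"
    unfolding interval_colorable_graphs_def by blast
  \<comment> \<open>The cut comes after \<open>n + 1\<close> because that is the number of lines
    through a point.\<close>
  moreover have split: "(\<Sum>i=1..?N. r i) = (\<Sum>i=1..n+1. r i) + (\<Sum>i=n+2..?N. r i)"
    using sum.ub_add_nat[of 1 "n + 1" r "n\<^sup>2"] by (simp add: add.commute add.left_commute)
  moreover have "(\<Sum>i=1..?N. r i) > 0"
    using split assms(6) by linarith
  ultimately obtain k where k: "k \<in> {1..?N}"
    and deg: "(\<Sum>i=1..?N. r i) \<le> card (incident_edges (Erd n l r) (Point k)) + 2 * (n + 1)"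
    using interval_coloring_Erd_point_degree assms(2,3) by blast
  let ?S = "{i \<in> {1..?N}. k \<in> l i}"
  \<comment> \<open>Injectivity of \<open>l\<close> turns the count of lines through
    \<open>k\<close> into a count of indices.\<close>
  have "card (l ` ?S) = card ?S"
    using assms(3) by (intro card_image) (auto simp: bij_betw_def inj_on_def)
  moreover have "l ` ?S = {m \<in> L. k \<in> m}"
    using assms(3) unfolding bij_betw_def by blast
  moreover have "card {m \<in> L. k \<in> m} = n + 1"
    using assms(2) k unfolding projective_plane_def by blast
  ultimately have "card ?S = n + 1" by simp
  then have "sum r ?S \<le> (\<Sum>i=1..n+1. r i)"
    by (intro sum_le_sum_initial_segment[of ?N] assms(4)) auto
  \<comment> \<open>Cancelling the first \<open>n + 1\<close> terms in \<open>deg\<close> leaves a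
    tail sum of at most \<open>2 * (n + 1)\<close>.\<close>
  with deg split assms(6) card_incident_edges_Erd_Point_le[of n l r k] show False
    by linarith
qed

end
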